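(* Fix an integer $k\ge 3$. Then, as $N\to\infty$, \[ f_k(N)\ge (\log N)^{c_k-o(1)},\qquad c_k:=\frac{k-2}{e\,((k-2)!)^{1/(k-2)}}. \] That is, for every $\varepsilon>0$ we have $f_k(N)\ge (\log N)^{c_k-\varepsilon}$ for all sufficiently large $N$.
   Context: For integers $k\ge 3$ and $N\ge1$, let $[N]=\{1,\dots,N\}$. A set $A\subseteq[N]$ is called LCM-$k$-free if it does not contain distinct $a_1,\dots,a_k$ such that $\operatorname{lcm}(a_i,a_j)$ is the same for all $1\le i<j\le k$. Define $f_k(N):=\max\{\sum_{a\in A}1/a : A\subseteq[N]\text{ is LCM-}k\text{-free}\}$. Here $\log$ is the natural logarithm. *)

theory Defs
  imports Complex_Main
begin

definition lcm_free :: "nat \<Rightarrow> nat set \<Rightarrow> bool" where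
  "lcm_free k A \<longleftrightarrow>
     \<not> (\<exists>a :: nat \<Rightarrow> nat. inj_on a {1..k} \<and> a ` {1..k} \<subseteq> A \<and>
          (\<exists>L. \<forall>i\<in>{1..k}. \<forall>j\<in>{1..k}. i < j \<longrightarrow> lcm (a i) (a j) = L))"

(* For k > 0 the set below is finite and nonempty (the empty set is a candidate),
   so Max is a genuine maximum. *)
definition lcm_free_max :: "nat \<Rightarrow> nat \<Rightarrow> real" where
  "lcm_free_max k N =
     Max {\<Sum>a\<in>A. 1 / real a | A. A \<subseteq> {1..N} \<and> lcm_free k A}"

definition lcm_free_exponent :: "nat \<Rightarrow> real" where
  "lcm_free_exponent k =
     (real k - 2) / (exp 1 * fact (k - 2) powr (1 / (real k - 2)))"

end

theory Submission
  imports Defs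
    "HOL-Computational_Algebra.Squarefree"
    "HOL-Analysis.Harmonic_Numbers"
    "HOL-Real_Asymp.Real_Asymp"
begin

text \<open>
  Write \<open>r = k - 2\<close> and \<open>l = e (r!)\<^bsup>1/r\<^esup>\<close>. Numbers that are products of exactly \<open>r\<close> distinct primes from
  each of \<open>m\<close> disjoint blocks of primes form an LCM-\<open>k\<close>-free set: if the pairwise unions of \<open>k\<close> sets of
  size \<open>r\<close> all equal \<open>L\<close>, then the complements in \<open>L\<close> are pairwise disjoint and all of size
  \<open>d = |L| - r\<close>, so \<open>(r + 2) d \<le> r + d\<close> and \<open>d = 0\<close>.
  If each block has reciprocal sum close to \<open>l\<close>, it contributes a factor of about
  \<open>l\<^sup>r / r! = e\<^sup>r\<close> to the harmonic sum, which is therefore about \<open>e\<^bsup>rm\<^esup>\<close>. By the lower bound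
  in Mertens' theorem, there is room for about \<open>m = ln (ln N) / l\<close> blocks, even with primes so small that
  all products stay below \<open>N\<close>. This choice of \<open>l\<close> maximises the resulting exponent
  \<open>ln (l\<^sup>r / r!) / l\<close>.
\<close>

section \<open>Set families with constant pairwise unions\<close>

definition const_unions :: "nat \<Rightarrow> (nat \<Rightarrow> 'a set) \<Rightarrow> 'a set \<Rightarrow> bool" where
  "const_unions k x L \<longleftrightarrow> (\<forall>i\<in>{1..k}. \<forall>j\<in>{1..k}. i < j \<longrightarrow> x i \<union> x j = L)"

text \<open>The \<open>x i\<close> are not assumed distinct: traces of distinct sets on a block may
  coincide, and this form can be applied to such traces.\<close>

definition rigid_family :: "nat \<Rightarrow> 'a set set \<Rightarrow> bool" where
  "rigid_family k F \<longleftrightarrow>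
     (\<forall>x L. x ` {1..k} \<subseteq> F \<longrightarrow> const_unions k x L \<longrightarrow> (\<forall>i\<in>{1..k}. x i = L))"

lemma const_unions_uniform_card:
  fixes x :: "nat \<Rightarrow> 'a set"
  assumes fin: "\<And>i. i \<in> {1..r+2} \<Longrightarrow> finite (x i)"
    and card: "\<And>i. i \<in> {1..r+2} \<Longrightarrow> card (x i) = r"
    and un: "const_unions (r+2) x L"
    and i: "i \<in> {1..r+2}"
  shows "x i = L"
proof -
  have L12: "x 1 \<union> x 2 = L"
    using un unfolding const_unions_def by auto
  then have finL: "finite L"
    using fin[of 1] fin[of 2] by auto
  have sub: "x j \<subseteq> L" if j: "j \<in> {1..r+2}" for j
  proof (cases "j = 1")
    case True
    then show ?thesis using L12 by blast
  next
    case False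
    then have "x 1 \<union> x j = L"
      using un j unfolding const_unions_def by auto
    then show ?thesis by blast
  qed
  define D where "D j = L - x j" for j
  have cD: "card (D j) = card L - r" if "j \<in> {1..r+2}" for j
    unfolding D_def using card_Diff_subset[OF fin[OF that] sub[OF that]] card[OF that] by simp
  have disj: "D a \<inter> D b = {}" if ab: "a \<in> {1..r+2}" "b \<in> {1..r+2}" "a \<noteq> b" for a b
  proof -
    have "x a \<union> x b = L"
      using un ab unfolding const_unions_def by (metis Un_commute linorder_neqE_nat)
    then show ?thesis unfolding D_def by blast
  qed
  have "card (\<Union>j\<in>{1..r+2}. D j) = (\<Sum>j\<in>{1..r+2}. card (D j))"
    by (rule card_UN_disjoint) (use finL disj in \<open>auto simp: D_def\<close>)
  also have "\<dots> = (r + 2) * (card L - r)"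
    using cD by simp
  finally have "(r + 2) * (card L - r) \<le> card L"
    using card_mono[OF finL, of "\<Union>j\<in>{1..r+2}. D j"] by (force simp: D_def)
  \<comment> \<open>This makes the truncated difference \<open>card L - r\<close> a true one, so
    that \<open>card L = r + d\<close> below.\<close>
  moreover have "r \<le> card L"
    using card_mono[OF finL sub[OF i]] card[OF i] by simp
  ultimately have "card L - r = 0"
  proof -
    assume a: "(r + 2) * (card L - r) \<le> card L" "r \<le> card L"
    obtain d where d: "card L = r + d" using a(2) le_Suc_ex by blast
    have "(r + 2) * d \<le> r + d" using a(1) d by simp
    then have "(r + 1) * d \<le> r" by simp
    then have "d = 0" by (cases d) auto
    then show ?thesis using d by simp
  qed
  then show ?thesis
    using sub[OF i] card[OF i] finL by (simp add: card_seteq)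
qed

section \<open>Elementary symmetric sums of small weights\<close>

text \<open>This is the \<open>r\<close>-th elementary symmetric polynomial in the weights on
  \<open>B\<close>.\<close>

definition uniform_weight :: "('a \<Rightarrow> real) \<Rightarrow> 'a set \<Rightarrow> nat \<Rightarrow> real" where
  "uniform_weight w B r = (\<Sum>Y | Y \<subseteq> B \<and> card Y = r. \<Prod>p\<in>Y. w p)"

text \<open>Double counting of pairs of an \<open>(r + 1)\<close>-set and one of its elements.\<close>
lemma uniform_weight_Suc:
  assumes B: "finite B"
  shows "real (Suc r) * uniform_weight w B (Suc r) =
         (\<Sum>Y | Y \<subseteq> B \<and> card Y = r. (\<Prod>p\<in>Y. w p) * (\<Sum>p\<in>B - Y. w p))"
proof -
  have fin: "finite {Y. Y \<subseteq> B \<and> card Y = n}" for n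
    using B by simp
  have finY: "finite Y" if "Y \<subseteq> B" for Y
    using B that finite_subset by blast
  have "(\<Sum>Y | Y \<subseteq> B \<and> card Y = r. (\<Prod>p\<in>Y. w p) * (\<Sum>p\<in>B - Y. w p))
      = (\<Sum>Y | Y \<subseteq> B \<and> card Y = r. \<Sum>p\<in>B - Y. (\<Prod>q\<in>insert p Y. w q))"
    using finY by (intro sum.cong refl) (auto simp: sum_distrib_left mult.commute intro!: sum.cong)
  also have "\<dots> = (\<Sum>(Y, p)\<in>Sigma {Y. Y \<subseteq> B \<and> card Y = r} (\<lambda>Y. B - Y). (\<Prod>q\<in>insert p Y. w q))"
    by (subst sum.Sigma) (use fin B in auto)
  also have "\<dots> = (\<Sum>(Z, p)\<in>Sigma {Z. Z \<subseteq> B \<and> card Z = Suc r} (\<lambda>Z. Z). (\<Prod>q\<in>Z. w q))"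
    by (rule sum.reindex_bij_witness[where i = "\<lambda>(Z, p). (Z - {p}, p)" and j = "\<lambda>(Y, p). (insert p Y, p)"])
       (auto simp: finY card_insert_if insert_absorb)
  also have "\<dots> = (\<Sum>Z | Z \<subseteq> B \<and> card Z = Suc r. \<Sum>p\<in>Z. (\<Prod>q\<in>Z. w q))"
    by (subst sum.Sigma) (use fin finY in auto)
  also have "\<dots> = real (Suc r) * uniform_weight w B (Suc r)"
    unfolding uniform_weight_def by (subst sum_distrib_left) (rule sum.cong, auto)
  finally show ?thesis by simp
qed

text \<open>The sets grow one element at a time. An \<open>r\<close>-set uses up at most
  \<open>r * \<eta>\<close> of the total weight, so weight at least \<open>c\<close> remains for the
  next element; by \<open>uniform_weight_Suc\<close> each step gains a factor
  \<open>c / (r + 1)\<close>.\<close>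

lemma uniform_weight_ge:
  assumes B: "finite B" and w0: "\<And>p. p \<in> B \<Longrightarrow> 0 \<le> w p" and w1: "\<And>p. p \<in> B \<Longrightarrow> w p \<le> \<eta>"
    and "0 \<le> c" "c + real r * \<eta> \<le> (\<Sum>p\<in>B. w p)" "0 \<le> \<eta>"
  shows "c ^ r / fact r \<le> uniform_weight w B r"
  using assms(5)
proof (induction r)
  case 0
  have "{Y. Y \<subseteq> B \<and> card Y = 0} = {{}}"
    using B finite_subset by fastforce
  then show ?case by (simp add: uniform_weight_def)
next
  case (Suc r)
  have pre: "c + real r * \<eta> \<le> (\<Sum>p\<in>B. w p)"
    using Suc.prems \<open>0 \<le> \<eta>\<close> by (simp add: algebra_simps)
  have "c ^ r / fact r * c \<le> uniform_weight w B r * c"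
    using Suc.IH[OF pre] \<open>0 \<le> c\<close> by (rule mult_right_mono)
  also have "\<dots> \<le> (\<Sum>Y | Y \<subseteq> B \<and> card Y = r. (\<Prod>p\<in>Y. w p) * (\<Sum>p\<in>B - Y. w p))"
    unfolding uniform_weight_def sum_distrib_right
  proof (intro sum_mono mult_left_mono)
    fix Y assume Y: "Y \<in> {Y. Y \<subseteq> B \<and> card Y = r}"
    then show "0 \<le> (\<Prod>p\<in>Y. w p)" using w0 by (auto intro!: prod_nonneg)
    have "(\<Sum>p\<in>Y. w p) \<le> real r * \<eta>"
      using sum_bounded_above[of Y w \<eta>] Y w1 by auto
    moreover have "(\<Sum>p\<in>B - Y. w p) = (\<Sum>p\<in>B. w p) - (\<Sum>p\<in>Y. w p)"
      using B Y by (intro sum_diff) auto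
    ultimately show "c \<le> (\<Sum>p\<in>B - Y. w p)" using pre by linarith
  qed
  also have "\<dots> = real (Suc r) * uniform_weight w B (Suc r)"
    using uniform_weight_Suc[OF B] by simp
  finally have "c ^ Suc r / fact r \<le> real (Suc r) * uniform_weight w B (Suc r)"
    by (simp add: mult.commute)
  then have "c ^ Suc r / fact r / real (Suc r) \<le> uniform_weight w B (Suc r)"
    by (subst pos_divide_le_eq) (auto simp: mult.commute)
  then show ?case by (simp add: mult.commute)
qed

text \<open>Greedy choice: elements are added until the sum first reaches \<open>l\<close>, and the
  last one added overshoots by at most \<eta>.\<close>

lemma subset_sum_between:
  fixes w :: "'a \<Rightarrow> real"
  assumes "finite S" "\<And>p. p \<in> S \<Longrightarrow> w p \<le> \<eta>" "0 \<le> \<eta>" "0 \<le> l" "l \<le> (\<Sum>p\<in>S. w p)"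
  shows "\<exists>B\<subseteq>S. l \<le> (\<Sum>p\<in>B. w p) \<and> (\<Sum>p\<in>B. w p) \<le> l + \<eta>"
  using assms
proof (induction S rule: finite_induct)
  case empty
  then show ?case by auto
next
  case (insert p S)
  show ?case
  proof (cases "l \<le> (\<Sum>p\<in>S. w p)")
    case True
    then show ?thesis using insert by (meson insertCI subset_insertI2)
  next
    case False
    moreover have "w p \<le> \<eta>" using insert.prems by auto
    ultimately have "(\<Sum>p\<in>insert p S. w p) \<le> l + \<eta>"
      using insert.hyps by simp
    then show ?thesis using insert.prems by blast
  qed
qed

text \<open>One block \<open>B\<close> is split off at a time, and every \<open>r\<close>-subset of
  \<open>B\<close> is joined to every set built on \<open>S - B\<close>. Weights then multiply, and
  rigidity can be checked separately on and off \<open>B\<close>. The common cardinality later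
  bounds the products of primes.\<close>

lemma exists_rigid_family:
  fixes w :: "'a \<Rightarrow> real"
  assumes "finite S" "\<And>p. p \<in> S \<Longrightarrow> 0 \<le> w p" "\<And>p. p \<in> S \<Longrightarrow> w p \<le> \<eta>" "0 \<le> \<eta>" "0 \<le> c"
    and "real m * (c + real (r + 1) * \<eta>) \<le> (\<Sum>p\<in>S. w p)"
  shows "\<exists>F. F \<subseteq> Pow S \<and> (\<forall>X\<in>F. card X = r * m) \<and> rigid_family (r+2) F \<and>
           (c ^ r / fact r) ^ m \<le> (\<Sum>X\<in>F. \<Prod>p\<in>X. w p)"
  using assms
proof (induction m arbitrary: S)
  case 0
  have "x i = L" if "x ` {1..r+2} \<subseteq> {{}}" "const_unions (r+2) x L" "i \<in> {1..r+2}" for x i and L :: "'a set"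
  proof -
    have "x 1 \<union> x 2 = L" using that(2) unfolding const_unions_def by auto
    moreover have "x 1 = {}" "x 2 = {}" "x i = {}" using that(1,3) by (auto simp: image_subset_iff)
    ultimately show ?thesis by simp
  qed
  then have "rigid_family (r+2) {{} :: 'a set}" unfolding rigid_family_def by blast
  then show ?case by (intro exI[of _ "{{}}"]) auto
next
  case (Suc m)
  \<comment> \<open>\<open>?l\<close> is the total that \<open>uniform_weight_ge\<close> asks of a
    block; the overshoot of at most \<eta> accounts for \<open>r + 1\<close> in the budget per
    block.\<close>
  let ?l = "c + real r * \<eta>"
  have l0: "0 \<le> ?l" using Suc.prems by simp
  have mu0: "0 \<le> c + real (r + 1) * \<eta>" using Suc.prems by simp
  have tot: "real m * (c + real (r + 1) * \<eta>) + (?l + \<eta>) \<le> (\<Sum>p\<in>S. w p)"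
    using Suc.prems(6) by (simp add: algebra_simps)
  have "0 \<le> real m * (c + real (r + 1) * \<eta>)" using mu0 by simp
  then have "?l \<le> (\<Sum>p\<in>S. w p)" using tot Suc.prems(4) by linarith
  then obtain B where B: "B \<subseteq> S" "?l \<le> (\<Sum>p\<in>B. w p)" "(\<Sum>p\<in>B. w p) \<le> ?l + \<eta>"
    using subset_sum_between[of S w \<eta> ?l] Suc.prems l0 by blast
  have finB: "finite B" using B(1) Suc.prems(1) finite_subset by blast
  have "(\<Sum>p\<in>S - B. w p) = (\<Sum>p\<in>S. w p) - (\<Sum>p\<in>B. w p)"
    using B(1) Suc.prems(1) by (intro sum_diff) auto
  then have "real m * (c + real (r + 1) * \<eta>) \<le> (\<Sum>p\<in>S - B. w p)"
    using tot B(3) by linarith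
  then obtain F where F: "F \<subseteq> Pow (S - B)" "\<And>X. X \<in> F \<Longrightarrow> card X = r * m"
    "rigid_family (r+2) F"
    "(c ^ r / fact r) ^ m \<le> (\<Sum>X\<in>F. \<Prod>p\<in>X. w p)"
    using Suc.IH[of "S - B"] Suc.prems(1-5) by (metis DiffD1 finite_Diff)
  define G where "G = {Y. Y \<subseteq> B \<and> card Y = r}"
  define H where "H = (\<lambda>(X, Y). X \<union> Y) ` (F \<times> G)"
  have parts: "Z - B \<in> F \<and> Z \<inter> B \<in> G" if Z: "Z \<in> H" for Z
  proof -
    obtain X Y where XY: "Z = X \<union> Y" "X \<in> F" "Y \<in> G" using Z by (auto simp: H_def)
    then have "Z - B = X" "Z \<inter> B = Y" using F(1) by (auto simp: G_def)
    then show ?thesis using XY by simp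
  qed
  have dj: "X \<inter> Y = {}" "finite X" "finite Y" if "X \<in> F" "Y \<in> G" for X Y
    using that F(1) Suc.prems(1) finB finite_subset[of Y B] finite_subset[of X S] by (auto simp: G_def)
  have inj: "inj_on (\<lambda>(X, Y). X \<union> Y) (F \<times> G)"
  proof (rule inj_onI, clarify)
    fix X Y X' Y' assume a: "X \<in> F" "Y \<in> G" "X' \<in> F" "Y' \<in> G" "X \<union> Y = X' \<union> Y'"
    then have "X = (X \<union> Y) - B" "Y = (X \<union> Y) \<inter> B" "X' = (X' \<union> Y') - B" "Y' = (X' \<union> Y') \<inter> B"
      using F(1) by (auto simp: G_def)
    then show "X = X' \<and> Y = Y'" using a(5) by metis
  qed
  \<comment> \<open>Constant unions persist after removing \<open>B\<close> and after intersecting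
    with \<open>B\<close>. The first trace is settled by the induction hypothesis, the second by the
    cardinality count.\<close>
  have "x i = L" if x: "x ` {1..r+2} \<subseteq> H" "const_unions (r+2) x L" and i: "i \<in> {1..r+2}" for x L i
  proof -
    have "(\<lambda>i. x i - B) ` {1..r+2} \<subseteq> F" using x(1) parts by (auto simp: image_subset_iff)
    moreover have "const_unions (r+2) (\<lambda>i. x i - B) (L - B)"
      using x(2) unfolding const_unions_def by (metis Un_Diff)
    ultimately have 1: "x i - B = L - B" using F(3) i unfolding rigid_family_def by blast
    have "const_unions (r+2) (\<lambda>i. x i \<inter> B) (L \<inter> B)"
      using x(2) unfolding const_unions_def by (metis Int_Un_distrib2)
    moreover have "x j \<inter> B \<in> G" if "j \<in> {1..r+2}" for j
      using x(1) parts that by (auto simp: image_subset_iff)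
    ultimately have 2: "x i \<inter> B = L \<inter> B"
      using i finB by (intro const_unions_uniform_card[where r = r and x = "\<lambda>i. x i \<inter> B"]) (auto simp: G_def)
    show ?thesis using 1 2 by blast
  qed
  then have rigid: "rigid_family (r+2) H" unfolding rigid_family_def by blast
  have "(c ^ r / fact r) ^ Suc m \<le> (\<Sum>X\<in>F. \<Prod>p\<in>X. w p) * uniform_weight w B r"
  proof -
    have "c ^ r / fact r \<le> uniform_weight w B r"
      using B Suc.prems finB by (intro uniform_weight_ge[where \<eta> = \<eta>]) auto
    moreover have "0 \<le> (\<Sum>X\<in>F. \<Prod>p\<in>X. w p)"
      using F(1) Suc.prems(2) by (intro sum_nonneg prod_nonneg) blast
    ultimately have "(c ^ r / fact r) ^ m * (c ^ r / fact r) \<le> (\<Sum>X\<in>F. \<Prod>p\<in>X. w p) * uniform_weight w B r"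
      using F(4) Suc.prems(5) by (intro mult_mono) auto
    then show ?thesis by (simp add: mult.commute)
  qed
  also have "\<dots> = (\<Sum>(X, Y)\<in>F \<times> G. (\<Prod>p\<in>X. w p) * (\<Prod>p\<in>Y. w p))"
    by (simp add: uniform_weight_def G_def sum_product sum.cartesian_product)
  also have "\<dots> = (\<Sum>(X, Y)\<in>F \<times> G. \<Prod>p\<in>X \<union> Y. w p)"
    using dj by (intro sum.cong refl) (auto simp: prod.union_disjoint)
  also have "\<dots> = (\<Sum>Z\<in>H. \<Prod>p\<in>Z. w p)"
    unfolding H_def by (subst sum.reindex[OF inj]) (simp add: case_prod_unfold comp_def)
  finally have sumH: "(c ^ r / fact r) ^ Suc m \<le> (\<Sum>Z\<in>H. \<Prod>p\<in>Z. w p)" .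
  have "card Z = r * Suc m" if Z: "Z \<in> H" for Z
  proof -
    obtain X Y where XY: "Z = X \<union> Y" "X \<in> F" "Y \<in> G" using Z by (auto simp: H_def)
    then show ?thesis using dj[OF XY(2,3)] F(2)[OF XY(2)] by (simp add: card_Un_disjoint G_def)
  qed
  moreover have "H \<subseteq> Pow S" using F(1) B(1) by (force simp: H_def G_def)
  ultimately show ?case using sumH rigid by (intro exI[of _ H]) blast
qed

section \<open>Products of distinct primes and reciprocal sums over primes\<close>

lemma prime_factors_prod_primes:
  fixes X :: "nat set"
  assumes "finite X" "\<And>p. p \<in> X \<Longrightarrow> prime p"
  shows "prime_factors (\<Prod>X) = X"
proof -
  have "prime_factors (\<Prod>X) = \<Union>((prime_factors \<circ> (\<lambda>x. x)) ` X)"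
    using assms by (intro prime_factors_prod) (auto dest: not_prime_0[THEN notE])
  also have "\<dots> = X" using assms(2) by (auto simp: prime_prime_factors)
  finally show ?thesis .
qed

lemma sum_inverse_squares_le: "(\<Sum>s=1..n. 1 / real s ^ 2) \<le> 2"
proof -
  \<comment> \<open>Strengthened so that the induction telescopes. Since \<open>1 / 0 = 0\<close>,
    the base case reads \<open>0 \<le> 2\<close>, and the step from 0 to 1 is treated apart.\<close>
  have "(\<Sum>s=1..n. 1 / real s ^ 2) \<le> 2 - 1 / real n"
  proof (induction n)
    case (Suc n)
    show ?case
    proof (cases "n = 0")
      case False
      then have "1 / real (Suc n) ^ 2 \<le> 1 / real n - 1 / real (Suc n)"
        by (simp add: divide_simps power2_eq_square)
      then show ?thesis using Suc.IH by simp
    qed simp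
  qed simp
  then show ?thesis by (smt (verit) divide_nonneg_nonneg of_nat_0_le_iff)
qed

text \<open>The lower half of Mertens' second theorem; the constant \<open>ln 2\<close> stems from
  the bound 2 on the sum of inverse squares.\<close>

lemma ln_ln_le_sum_inverse_primes:
  assumes n: "n \<ge> 2"
  shows "ln (ln (real n)) - ln 2 \<le> (\<Sum>p | prime p \<and> p \<le> n. 1 / real p)"
proof -
  define P where "P = {p. prime p \<and> p \<le> n}"
  have finP: "finite P" unfolding P_def by simp
  \<comment> \<open>Every \<open>a \<le> n\<close> is a squarefree number times a square; this bounds the harmonic sum by
    \<open>2 \<Prod>\<^bsub>p \<le> n\<^esub> (1 + 1/p)\<close> without an infinite Euler product.\<close>
  let ?f = "\<lambda>(X, s). \<Prod>X * s ^ 2 :: nat"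
  have cover: "{1..n} \<subseteq> ?f ` (Pow P \<times> {1..n})"
  proof
    fix a assume a: "a \<in> {1..n}"
    then have a0: "a \<noteq> 0" by auto
    define X where "X = prime_factors (squarefree_part a)"
    have eq: "a = squarefree_part a * square_part a ^ 2"
      by (rule squarefree_decompose)
    have "squarefree_part a = (\<Prod>p\<in>X. p ^ multiplicity p (squarefree_part a))"
      unfolding X_def by (rule prime_factorization_nat) (simp add: zero_less_iff_neq_zero)
    also have "\<dots> = \<Prod>X"
    proof (rule prod.cong[OF refl])
      fix p assume "p \<in> X"
      then have "prime p" "multiplicity p (squarefree_part a) > 0"
        by (auto simp: X_def prime_factors_multiplicity)
      then have "multiplicity p (squarefree_part a) = 1"
        using prime_multiplicity_squarefree_part_le_Suc_0[of p a] by simp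
      then show "p ^ multiplicity p (squarefree_part a) = p" by simp
    qed
    finally have sp: "squarefree_part a = \<Prod>X" .
    have "squarefree_part a dvd a" using eq by (metis dvd_triv_left)
    then have "prime p \<and> p dvd a" if "p \<in> X" for p
      using that dvd_trans[of p "squarefree_part a" a] by (auto simp: X_def in_prime_factors_iff)
    then have "X \<subseteq> P"
      using a a0 by (auto simp: P_def dest: dvd_imp_le intro: le_trans)
    moreover have "square_part a \<in> {1..n}"
    proof -
      have "square_part a dvd a" using eq by (metis dvd_triv_right dvd_trans dvd_power zero_less_numeral)
      then have "square_part a \<le> a" "0 < square_part a"
        using a0 by (auto intro: dvd_imp_le dvd_pos_nat)
      then show ?thesis using a by simp
    qed
    ultimately show "a \<in> ?f ` (Pow P \<times> {1..n})"
      using eq sp by (intro image_eqI[of _ _ "(X, square_part a)"]) auto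
  qed
  have "ln (real n) \<le> ln (real n + 1)" using n by simp
  also have "\<dots> \<le> harm n" using ln_le_harm by simp
  also have "\<dots> = (\<Sum>a\<in>{1..n}. 1 / real a)" by (simp add: harm_def field_simps)
  also have "\<dots> \<le> (\<Sum>a\<in>?f ` (Pow P \<times> {1..n}). 1 / real a)"
    using cover finP by (intro sum_mono2) auto
  also have "\<dots> \<le> (\<Sum>Xs\<in>Pow P \<times> {1..n}. 1 / real (?f Xs))"
    using finP sum_image_le[of "Pow P \<times> {1..n}" "\<lambda>a. 1 / real a" ?f] by (simp add: comp_def)
  also have "\<dots> = (\<Sum>X\<in>Pow P. \<Prod>p\<in>X. 1 / real p) * (\<Sum>s=1..n. 1 / real s ^ 2)"
    by (simp add: sum_product sum.cartesian_product case_prod_unfold prod_dividef)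
  \<comment> \<open>Expanding the product, each \<open>X\<close> records the factors that contribute
    \<open>1 / p\<close> rather than 1.\<close>
  also have "(\<Sum>X\<in>Pow P. \<Prod>p\<in>X. 1 / real p) = (\<Prod>p\<in>P. 1 / real p + 1)"
    using prod_add[OF finP, of "\<lambda>p. 1 / real p" "\<lambda>_. 1"] by simp
  also have "(\<Prod>p\<in>P. 1 / real p + 1) * (\<Sum>s=1..n. 1 / real s ^ 2) \<le> exp (\<Sum>p\<in>P. 1 / real p) * 2"
  proof (rule mult_mono)
    show "(\<Prod>p\<in>P. 1 / real p + 1) \<le> exp (\<Sum>p\<in>P. 1 / real p)"
      unfolding exp_sum[OF finP] by (intro prod_mono) (auto simp: exp_ge_add_one_self add.commute)
    show "(\<Sum>s=1..n. 1 / real s ^ 2) \<le> 2" by (rule sum_inverse_squares_le)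
  qed (auto intro: sum_nonneg)
  finally have "ln (real n) \<le> 2 * exp (\<Sum>p\<in>P. 1 / real p)" by simp
  moreover have "0 < ln (real n)" using n by simp
  ultimately have "ln (ln (real n)) \<le> ln (2 * exp (\<Sum>p\<in>P. 1 / real p))" by simp
  then show ?thesis by (simp add: ln_mult P_def)
qed

text \<open>Only finitely many primes lie below \<open>1 / \<eta>\<close>; their reciprocal sum is
  absorbed into \<open>K\<close>, which depends on \<eta> but not on \<open>n\<close>.\<close>

lemma ln_ln_le_sum_inverse_large_primes:
  fixes \<eta> :: real
  assumes "0 < \<eta>"
  shows "\<exists>K. \<forall>n\<ge>2. ln (ln (real n)) - K \<le> (\<Sum>p | prime p \<and> p \<le> n \<and> 1 / real p \<le> \<eta>. 1 / real p)"
proof -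
  define Q where "Q = {p. prime p \<and> \<not> 1 / real p \<le> \<eta>}"
  have "Q \<subseteq> {..nat \<lceil>1 / \<eta>\<rceil>}"
  proof
    fix p assume "p \<in> Q"
    then have "\<eta> < 1 / real p" "0 < real p" by (auto simp: Q_def prime_gt_0_nat)
    then have "real p < 1 / \<eta>" using assms by (simp add: field_simps)
    then show "p \<in> {..nat \<lceil>1 / \<eta>\<rceil>}" by (simp; linarith)
  qed
  then have finQ: "finite Q" using finite_subset by blast
  have "ln (ln (real n)) - (ln 2 + (\<Sum>p\<in>Q. 1 / real p)) \<le> (\<Sum>p | prime p \<and> p \<le> n \<and> 1 / real p \<le> \<eta>. 1 / real p)"
    if n: "n \<ge> 2" for n
  proof -
    let ?R = "{p. prime p \<and> p \<le> n \<and> 1 / real p \<le> \<eta>}"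
    have "(\<Sum>p | prime p \<and> p \<le> n. 1 / real p) \<le> (\<Sum>p\<in>?R \<union> Q. 1 / real p)"
      using finQ by (intro sum_mono2) (auto simp: Q_def)
    also have "\<dots> = (\<Sum>p\<in>?R. 1 / real p) + (\<Sum>p\<in>Q. 1 / real p)"
      using finQ by (intro sum.union_disjoint) (auto simp: Q_def)
    finally show ?thesis using ln_ln_le_sum_inverse_primes[OF n] by linarith
  qed
  then show ?thesis by blast
qed

section \<open>From rigid families to LCM-free sets of integers\<close>

lemma lcm_free_max_ge:
  assumes "A \<subseteq> {1..N}" "lcm_free k A"
  shows "(\<Sum>a\<in>A. 1 / real a) \<le> lcm_free_max k N"
proof -
  have "{\<Sum>a\<in>A. 1 / real a | A. A \<subseteq> {1..N} \<and> lcm_free k A} \<subseteq> (\<lambda>A. \<Sum>a\<in>A. 1 / real a) ` Pow {1..N}"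
    by auto
  then have "finite {\<Sum>a\<in>A. 1 / real a | A. A \<subseteq> {1..N} \<and> lcm_free k A}"
    by (rule finite_subset) simp
  then show ?thesis unfolding lcm_free_max_def using assms by (intro Max_ge) auto
qed

text \<open>A set of primes is encoded by its product, so an lcm corresponds to a union: equal
  pairwise lcms give constant unions, and rigidity then contradicts distinctness. Each product has
  \<open>r * m\<close> factors of size at most \<open>n\<close>, hence stays within
  \<open>N\<close>.\<close>

lemma lcm_free_max_ge_power:
  assumes S: "\<And>p. p \<in> S \<Longrightarrow> prime p \<and> p \<le> n \<and> 1 / real p \<le> \<eta>"
    and "0 \<le> \<eta>" "0 \<le> c" and N: "n ^ (r * m) \<le> N"
    and sum: "real m * (c + real (r + 1) * \<eta>) \<le> (\<Sum>p\<in>S. 1 / real p)"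
  shows "(c ^ r / fact r) ^ m \<le> lcm_free_max (r + 2) N"
proof -
  have "S \<subseteq> {..n}" using S by auto
  then have finS: "finite S" using finite_subset by blast
  obtain F where F: "F \<subseteq> Pow S" "\<And>X. X \<in> F \<Longrightarrow> card X = r * m"
    "rigid_family (r+2) F"
    "(c ^ r / fact r) ^ m \<le> (\<Sum>X\<in>F. \<Prod>p\<in>X. 1 / real p)"
    using exists_rigid_family[of S "\<lambda>p. 1 / real p" \<eta> c m r] finS S assms(2,3) sum by auto
  have pf: "prime_factors (\<Prod>X) = X" if "X \<in> F" for X
    using that F(1) finS S by (intro prime_factors_prod_primes) (auto intro: finite_subset)
  have inj: "inj_on Prod F" using pf by (metis inj_onI)
  have pos: "\<Prod>X > 0" if "X \<in> F" for X
    using that F(1) S by (intro prod_pos) (force simp: prime_gt_0_nat)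
  have "Prod ` F \<subseteq> {1..N}"
  proof clarify
    fix X assume X: "X \<in> F"
    have "\<Prod>X \<le> (\<Prod>p\<in>X. n)" using X F(1) S by (intro prod_mono) auto
    also have "\<dots> \<le> N" using F(2)[OF X] N by simp
    finally show "\<Prod>X \<in> {1..N}" using pos[OF X] by simp
  qed
  moreover have "lcm_free (r + 2) (Prod ` F)"
    unfolding lcm_free_def
  proof (rule notI, elim exE conjE)
    fix a L
    assume a: "inj_on a {1..r+2}" "a ` {1..r+2} \<subseteq> Prod ` F"
      "\<forall>i\<in>{1..r+2}. \<forall>j\<in>{1..r+2}. i < j \<longrightarrow> lcm (a i) (a j) = L"
    define x where "x i = prime_factors (a i)" for i
    have ax: "x i \<in> F \<and> a i = \<Prod>(x i)" if i: "i \<in> {1..r+2}" for i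
    proof -
      obtain X where "X \<in> F" "a i = \<Prod>X" using a(2) i by blast
      then show ?thesis using pf by (simp add: x_def)
    qed
    have "const_unions (r+2) x (prime_factors L)"
      unfolding const_unions_def
    proof (intro ballI impI)
      fix i j assume ij: "i \<in> {1..r+2}" "j \<in> {1..r+2}" "i < j"
      have "a i \<noteq> 0" "a j \<noteq> 0" using ax pos ij by (metis less_irrefl)+
      then have "prime_factors (lcm (a i) (a j)) = x i \<union> x j"
        unfolding x_def by (rule prime_factors_lcm)
      then show "x i \<union> x j = prime_factors L" using a(3) ij by auto
    qed
    then have "\<forall>i\<in>{1..r+2}. x i = prime_factors L" using F(3) ax unfolding rigid_family_def by blast
    then have "x 1 = x 2" by simp
    then have "a 1 = a 2" using ax[of 1] ax[of 2] by simp
    then show False using inj_onD[OF a(1), of 1 2] by simp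
  qed
  ultimately have "(\<Sum>a\<in>Prod ` F. 1 / real a) \<le> lcm_free_max (r + 2) N"
    by (rule lcm_free_max_ge)
  moreover have "(\<Sum>a\<in>Prod ` F. 1 / real a) = (\<Sum>X\<in>F. \<Prod>p\<in>X. 1 / real p)"
    by (subst sum.reindex[OF inj]) (simp add: prod_dividef)
  ultimately show ?thesis using F(4) by simp
qed

section \<open>Choice of parameters and asymptotics\<close>

text \<open>Each block costs slightly more than \<open>l\<close> out of a budget of about
  \<open>ln (ln N)\<close> and gains a factor \<open>exp r\<close>, which yields every exponent
  below \<open>r / l\<close>.\<close>

lemma eventually_lcm_free_max_ge:
  fixes l d :: real
  assumes l: "0 < l" "l ^ r / fact r = exp (real r)" and d: "d < real r / l"
  shows "\<forall>\<^sub>F N in sequentially. ln (real N) powr d \<le> lcm_free_max (r + 2) N"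
proof -
  \<comment> \<open>By continuity at 0, \<eta> can be fixed so small that the cost \<mu> of a block
    still satisfies \<open>d < r / \<mu>\<close>.\<close>
  have "((\<lambda>\<eta>. real r / (l + real (r + 1) * \<eta>)) \<longlongrightarrow> real r / (l + real (r + 1) * 0)) (at_right 0)"
    using l by (intro tendsto_intros) auto
  then have "\<forall>\<^sub>F \<eta> in at_right 0. d < real r / (l + real (r + 1) * \<eta>)"
    using d by (auto dest: order_tendstoD)
  moreover have "\<forall>\<^sub>F \<eta>::real in at_right 0. 0 < \<eta>" by (simp add: eventually_at_filter)
  ultimately have "\<forall>\<^sub>F \<eta> in at_right 0. 0 < \<eta> \<and> d < real r / (l + real (r + 1) * \<eta>)"
    by eventually_elim simp
  then obtain \<eta> :: real where \<eta>: "0 < \<eta>" "d < real r / (l + real (r + 1) * \<eta>)"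
    using eventually_happens' trivial_limit_at_right_real by (metis (mono_tags, lifting))
  define \<mu> where "\<mu> = l + real (r + 1) * \<eta>"
  have \<mu>: "0 < \<mu>" "d < real r / \<mu>" using \<eta> l by (auto simp: \<mu>_def intro: add_pos_nonneg)
  obtain K where K: "\<And>n. n \<ge> 2 \<Longrightarrow>
      ln (ln (real n)) - K \<le> (\<Sum>p | prime p \<and> p \<le> n \<and> 1 / real p \<le> \<eta>. 1 / real p)"
    using ln_ln_le_sum_inverse_large_primes[OF \<eta>(1)] by blast
  \<comment> \<open>Nonnegativity ensures \<open>?E \<ge> 1\<close> below.\<close>
  define K' where "K' = max K 0"
  have K': "K \<le> K'" "0 \<le> K'" by (auto simp: K'_def)
  define a where "a = real r / \<mu> - d"
  have a: "0 < a" using \<mu> by (simp add: a_def)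
  have T: "filterlim (\<lambda>N::nat. ln (ln (real N))) at_top sequentially" by real_asymp
  \<comment> \<open>With \<open>T = ln (ln N)\<close>, the second condition keeps \<open>m\<close>
    from being truncated at 0, the third absorbs the constants in the size of the products, and in
    the last the slack \<open>a * T\<close> pays for \<open>2 * ln T\<close> and for rounding
    \<open>m\<close> down.\<close>
  have "\<forall>\<^sub>F T in at_top. 1 \<le> T \<and> 2 * ln T \<le> T \<and> 2 * real r * exp K' / \<mu> \<le> T \<and>
          0 \<le> a * T - 2 * real r / \<mu> * ln T - real r"
  proof (intro eventually_conj)
    show "\<forall>\<^sub>F T::real in at_top. 2 * ln T \<le> T" by real_asymp
    show "\<forall>\<^sub>F T in at_top. 0 \<le> a * T - 2 * real r / \<mu> * ln T - real r" using a by real_asymp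
  qed (rule eventually_ge_at_top)+
  from eventually_compose_filterlim[OF this T] eventually_ge_at_top[of 3]
  show ?thesis
  proof eventually_elim
    case (elim N)
    define T where "T = ln (ln (real N))"
    have T: "1 \<le> T" "2 * ln T \<le> T" "2 * real r * exp K' / \<mu> \<le> T"
        "0 \<le> a * T - 2 * real r / \<mu> * ln T - real r" and N3: "N \<ge> 3"
      using elim by (auto simp: T_def)
    have lnN: "0 < ln (real N)" using N3 by simp
    have NT: "real N = exp (exp T)" using lnN N3 by (simp add: T_def)
    \<comment> \<open>The loss \<open>2 ln T\<close> makes room for the factor \<open>r m\<close> in \<open>ln (n\<^bsup>rm\<^esup>) = r m ln n\<close>.\<close>
    define m where "m = nat \<lfloor>(T - 2 * ln T) / \<mu>\<rfloor>"
    have q0: "0 \<le> (T - 2 * ln T) / \<mu>" using T \<mu> by simp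
    have m_le: "real m \<le> (T - 2 * ln T) / \<mu>" using q0 by (simp add: m_def)
    have m_ge: "(T - 2 * ln T) / \<mu> - 1 \<le> real m" using q0 unfolding m_def by linarith
    have m\<mu>: "real m * \<mu> \<le> T - 2 * ln T" using m_le \<mu> by (simp add: field_simps)
    \<comment> \<open>Chosen so that the Mertens bound, after losing \<open>K\<close>, still leaves
      weight \<open>m * \<mu>\<close> for the \<open>m\<close> blocks.\<close>
    define n where "n = nat \<lceil>exp (exp (real m * \<mu> + K'))\<rceil>"
    let ?E = "exp (real m * \<mu> + K')"
    have E1: "1 \<le> ?E" using K' \<mu> by simp
    have n_ge: "exp ?E \<le> real n" unfolding n_def by linarith
    have "(2::real) \<le> exp 1" using exp_ge_add_one_self[of 1] by simp
    also have "\<dots> \<le> exp ?E" using E1 by simp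
    finally have E2: "2 \<le> exp ?E" .
    then have n2: "n \<ge> 2" using n_ge by linarith
    \<comment> \<open>The rounding error of the ceiling is absorbed by squaring:
      \<open>x + 1 \<le> x * x\<close> for \<open>x \<ge> 2\<close>.\<close>
    have "real n \<le> exp ?E + 1" unfolding n_def using E2 by linarith
    also have "\<dots> \<le> exp ?E * exp ?E" using E2 mult_mono[of 2 "exp ?E" "exp ?E" "exp ?E"] by linarith
    also have "\<dots> = exp (2 * ?E)" by (simp flip: exp_add)
    finally have n_le: "real n \<le> exp (2 * ?E)" .
    have "ln (exp ?E) \<le> ln (real n)" using n_ge n2 by (subst ln_le_cancel_iff) auto
    then have "?E \<le> ln (real n)" by simp
    then have "ln ?E \<le> ln (ln (real n))" by (intro ln_mono) auto
    then have lln: "real m * \<mu> + K' \<le> ln (ln (real n))" by simp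
    have sum: "real m * \<mu> \<le> (\<Sum>p | prime p \<and> p \<le> n \<and> 1 / real p \<le> \<eta>. 1 / real p)"
      using K[OF n2] lln K' by linarith
    have "real (r * m) * (2 * ?E) = (2 * real r * exp K') * real m * exp (real m * \<mu>)"
      by (simp add: exp_add)
    also have "\<dots> \<le> (2 * real r * exp K') * (T / \<mu>) * exp (T - 2 * ln T)"
    proof (intro mult_mono)
      have "(T - 2 * ln T) / \<mu> \<le> T / \<mu>" using T \<mu> by (intro divide_right_mono) auto
      then show "real m \<le> T / \<mu>" using m_le by linarith
    qed (use m\<mu> T \<mu> in auto)
    also have "\<dots> = (2 * real r * exp K' / \<mu>) * T * exp (T - 2 * ln T)" by simp
    \<comment> \<open>One factor \<open>T\<close> comes from the bound on \<open>m\<close>, the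
      other from the constants; together they cancel \<open>exp (- 2 * ln T)\<close>.\<close>
    also have "\<dots> \<le> T * T * exp (T - 2 * ln T)"
      using T by (intro mult_right_mono) auto
    also have "\<dots> = exp T"
    proof -
      have "exp (2 * ln T) = T * T" using T by (simp add: exp_double power2_eq_square)
      then show ?thesis using T by (simp add: exp_diff)
    qed
    finally have expo: "real (r * m) * (2 * ?E) \<le> exp T" .
    have "real n ^ (r * m) \<le> exp (2 * ?E) ^ (r * m)" using n_le by (intro power_mono) auto
    also have "\<dots> = exp (real (r * m) * (2 * ?E))" by (rule exp_of_nat_mult[symmetric])
    also have "\<dots> \<le> real N" using expo by (simp add: NT)
    finally have nN: "n ^ (r * m) \<le> N" by (metis of_nat_le_iff of_nat_power)
    have "d * T \<le> real r * ((T - 2 * ln T) / \<mu> - 1)"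
      using T(4) by (simp add: a_def algebra_simps diff_divide_distrib)
    also have "\<dots> \<le> real r * real m" using m_ge by (intro mult_left_mono) auto
    finally have dT: "d * T \<le> real r * real m" .
    have "ln (real N) powr d = exp (d * T)" using lnN by (simp add: powr_def T_def)
    also have "\<dots> \<le> exp (real m * real r)" using dT by (simp add: mult.commute)
    also have "\<dots> = (l ^ r / fact r) ^ m" unfolding l(2) by (rule exp_of_nat_mult)
    also have "\<dots> \<le> lcm_free_max (r + 2) N"
      using nN sum \<eta> l n2 unfolding \<mu>_def by (intro lcm_free_max_ge_power[where n = n and \<eta> = \<eta>]) auto
    finally show ?case .
  qed
qed

theorem theorem1p3:
  fixes k :: nat
  assumes "k \<ge> 3"
  shows "\<forall>\<epsilon>>0. \<forall>\<^sub>F N in sequentially.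
           lcm_free_max k N \<ge> ln (real N) powr (lcm_free_exponent k - \<epsilon>)"
proof (intro allI impI)
  fix \<epsilon> :: real assume \<epsilon>: "\<epsilon> > 0"
  define r where "r = k - 2"
  have r: "r \<ge> 1" "k = r + 2" using assms by (auto simp: r_def)
  \<comment> \<open>This \<open>l\<close> solves \<open>l ^ r / fact r = exp r\<close>;
    \<open>k \<ge> 3\<close> gives \<open>r \<ge> 1\<close>, so the \<open>r\<close>-th root is
    meaningful.\<close>
  define l :: real where "l = exp 1 * fact r powr (1 / real r)"
  have l0: "0 < l" by (simp add: l_def)
  have "l ^ r = exp 1 ^ r * (fact r powr (1 / real r)) ^ r"
    by (simp add: l_def power_mult_distrib)
  also have "(fact r powr (1 / real r)) ^ r = (fact r :: real)"
    using r by (simp add: powr_powr flip: powr_realpow)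
  also have "exp 1 ^ r = (exp (real r) :: real)" by (simp flip: exp_of_nat_mult)
  finally have l: "l ^ r / fact r = exp (real r)" by simp
  have "lcm_free_exponent k = real r / l" using r by (simp add: lcm_free_exponent_def l_def)
  then show "\<forall>\<^sub>F N in sequentially. ln (real N) powr (lcm_free_exponent k - \<epsilon>) \<le> lcm_free_max k N"
    using eventually_lcm_free_max_ge[OF l0 l, of "lcm_free_exponent k - \<epsilon>"] \<epsilon> r(2) by simp
qed

end
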